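(* Let $\alpha>0$ and let $g:\mathbb{R}^n\to[0,\infty)$ be a continuous integrable $\alpha$-concave function such that $g(0)>0$. For any $0<p<q$, $$\binom{\frac1\alpha+q}{\frac1\alpha}^{1/q}K_q(g)\subseteq\binom{\frac1\alpha+p}{\frac1\alpha}^{1/p}K_p(g).$$ Besides, if there exist $0<p<q$ such that this inclusion is an equality, then $\Vert g\Vert_\infty=g(0)$ and, for every $x\in\mathbb{R}^n$, $$\frac{g(x)}{g(0)}=(1-\Vert x\Vert_L)^{1/\alpha}\chi_L(x),$$ where $L=\operatorname{supp} g$ is the support of $g$.
   Context: A function $g:\mathbb{R}^n\to[0,\infty)$ is $\alpha$-concave ($\alpha>0$) if its support is convex and $g^\alpha$ is concave on its support. (Such a function is in particular log-concave.) For a log-concave function $g:\mathbb{R}^n\to[0,\infty)$ with $g(0)>0$ and $p>0$, the Ball body $K_p(g)$ is $$K_p(g)=\left\{x\in\mathbb{R}^n:\int_0^\infty pt^{p-1}g(tx)\,dt\ge g(0)\right\}.$$ $\chi_L$ denotes the characteristic (indicator) function of $L$; $\Vert x\Vert_L=\inf\{\lambda>0: x\in\lambda L\}$ is the Minkowski functional of $L$; $\Vert g\Vert_\infty$ is the supremum norm of $g$. Generalized binomial coefficients are defined for $x,y>0$ by $\binom{x}{y}=\frac{\Gamma(1+x)}{\Gamma(1+y)\Gamma(1+x-y)}$. *)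

theory Defs
  imports "HOL-Analysis.Analysis"
begin

text \<open>
  The topological support. For continuous \<open>g\<close> the notions below are the same for the
  closed support and for the open set \<open>{x. g x \<noteq> 0}\<close>: each of the two sets is convex with
  \<open>g\<close> to the power \<open>\<alpha>\<close> concave on it iff the other one is, and the extremal function
  in the equality case vanishes where the Minkowski functional equals 1.
\<close>

definition supp :: "('a::topological_space \<Rightarrow> real) \<Rightarrow> 'a set" where
  "supp g = closure {x. g x \<noteq> 0}"

text \<open>Only meant for nonnegative \<open>g\<close> and \<open>\<alpha> > 0\<close>; note \<open>0 powr \<alpha> = 0\<close>.\<close>

definition alpha_concave :: "real \<Rightarrow> ('a::real_normed_vector \<Rightarrow> real) \<Rightarrow> bool" where
  "alpha_concave \<alpha> g \<longleftrightarrow> convex (supp g) \<and> concave_on (supp g) (\<lambda>x. g x powr \<alpha>)"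

text \<open>
  The integral takes values in \<open>[0, \<infinity>]\<close>: it diverges at \<open>x = 0\<close>, so that
  \<open>0\<close> belongs to the Ball body whenever \<open>p > 0\<close> and \<open>g 0 > 0\<close>.
\<close>

definition ball_body :: "real \<Rightarrow> ('a::real_normed_vector \<Rightarrow> real) \<Rightarrow> 'a set" where
  "ball_body p g =
     {x. (\<integral>\<^sup>+ t\<in>{0<..}. ennreal (p * t powr (p - 1) * g (t *\<^sub>R x)) \<partial>lborel) \<ge> ennreal (g 0)}"

definition minkowski_functional :: "'a::real_vector set \<Rightarrow> 'a \<Rightarrow> real" where
  "minkowski_functional L x = Inf {l. l > 0 \<and> x \<in> (\<lambda>y. l *\<^sub>R y) ` L}"

definition sup_norm :: "('a \<Rightarrow> real) \<Rightarrow> ennreal" where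
  "sup_norm g = (SUP x. ennreal \<bar>g x\<bar>)"

text \<open>The library's \<open>gchoose\<close> only allows a natural number as lower argument.\<close>

definition gen_binom :: "real \<Rightarrow> real \<Rightarrow> real" where
  "gen_binom x y = Gamma (1 + x) / (Gamma (1 + y) * Gamma (1 + x - y))"

end

theory Submission
  imports Defs
begin

text \<open>
  Everything happens on rays. For \<open>x \<noteq> 0\<close> let \<open>f t = g (t *\<^sub>R x) / g 0\<close>, and compare it with the profile
  \<open>h t = max 0 (1 - t/T) powr (1/\<alpha>)\<close>, where \<open>T\<close> is chosen such that \<open>f\<close> and \<open>h\<close> have the same
  moment of order \<open>p\<close>; the generalized binomial coefficient is the ratio between \<open>T powr p\<close> and the
  \<open>p\<close>-th moment of \<open>h\<close>, a Beta integral. Since \<open>f powr \<alpha>\<close> is concave on its support while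
  \<open>h powr \<alpha>\<close> is linear with the same value at \<open>0\<close>, the difference \<open>h - f\<close> changes sign at most
  once, from \<open>-\<close> to \<open>+\<close>, say at \<open>r\<close>. Integrating
  \<open>(t powr (q - p) - r powr (q - p)) * t powr (p - 1) * (h t - f t) \<ge> 0\<close> gives the comparison of the
  moments of order \<open>q\<close>, with equality only if \<open>f = h\<close>. The moments are homogeneous in \<open>x\<close>, so
  equality of the scaled Ball bodies forces equality of the moments on every ray.
\<close>

section \<open>Moments of functions on the half-line\<close>

text \<open>The factor \<open>p\<close> of the Ball body is kept outside. As a Bochner integral,
  this carries information only for integrable integrands.\<close>

definition moment :: "real \<Rightarrow> (real \<Rightarrow> real) \<Rightarrow> real" where
  "moment p f = (LINT t:{0<..}|lborel. t powr (p - 1) * f t)"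

text \<open>Truncating before taking the power keeps the base nonnegative: for
  \<open>\<alpha> > 0\<close> and \<open>T > 0\<close> the profile is continuous on the whole line
  and vanishes from \<open>T\<close> on.\<close>

definition profile :: "real \<Rightarrow> real \<Rightarrow> real \<Rightarrow> real" where
  "profile \<alpha> T t = max 0 (1 - t / T) powr (1/\<alpha>)"

text \<open>On the bounded interval carrying the integrand, \<open>f\<close> is bounded, so a
  multiple of \<open>t powr (p - 1)\<close> dominates; its possible singularity at \<open>0\<close>
  is integrable because \<open>p > 0\<close>.\<close>

lemma moment_integrable:
  fixes f :: "real \<Rightarrow> real"
  assumes "0 < p" and cont: "continuous_on UNIV f" and R: "\<And>t. R < t \<Longrightarrow> f t = 0"
  shows "set_integrable lborel {0<..} (\<lambda>t. t powr (p - 1) * f t)"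
proof -
  define R' where "R' = max R 0"
  have [measurable]: "f \<in> borel_measurable borel"
    using cont by (rule borel_measurable_continuous_onI)
  have "compact (f ` {0..R'})"
    by (intro compact_continuous_image continuous_on_subset[OF cont]) auto
  then obtain M where M: "\<And>t. t \<in> {0..R'} \<Longrightarrow> \<bar>f t\<bar> \<le> M"
    by (metis compact_imp_bounded bounded_real imageI)
  have "(\<lambda>t. t powr (p - 1)) absolutely_integrable_on {0..R'}"
    using assms by (intro nonnegative_absolutely_integrable_1 integrable_on_powr_from_0) (auto simp: R'_def)
  then have "set_integrable lborel {0..R'} (\<lambda>t. t powr (p - 1))"
    by (simp add: set_integrable_def integrable_completion)
  then have "set_integrable lborel {0..R'} (\<lambda>t. M * t powr (p - 1))"
    by simp
  then have "integrable lborel (\<lambda>t. indicator {0..R'} t * (M * t powr (p - 1)))"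
    by (simp add: set_integrable_def)
  then show ?thesis
    unfolding set_integrable_def
  proof (rule Bochner_Integration.integrable_bound)
    show "AE t in lborel. norm (indicat_real {0<..} t *\<^sub>R (t powr (p - 1) * f t))
            \<le> norm (indicat_real {0..R'} t * (M * t powr (p - 1)))"
    proof (intro AE_I2)
      fix t
      have "\<bar>f t\<bar> * t powr (p - 1) \<le> \<bar>M\<bar> * t powr (p - 1)" if "t \<in> {0..R'}"
        using M[OF that] by (intro mult_right_mono) auto
      then show "norm (indicat_real {0<..} t *\<^sub>R (t powr (p - 1) * f t))
            \<le> norm (indicat_real {0..R'} t * (M * t powr (p - 1)))"
        using R[of t] by (auto simp: indicator_def abs_mult R'_def mult.commute)
    qed
  qed measurable
qed

text \<open>Passes from the extended-valued integral of \<open>ball_body\<close> to real moments,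
  which can be subtracted.\<close>

lemma moment_eq_nn_integral:
  assumes "0 < p" and "continuous_on UNIV f" and "\<And>t. R < t \<Longrightarrow> f t = 0" and "\<And>t. 0 \<le> f t"
  shows "(\<integral>\<^sup>+ t\<in>{0<..}. ennreal (p * t powr (p - 1) * f t) \<partial>lborel) = ennreal (p * moment p f)"
proof -
  have i: "integrable lborel (\<lambda>t. p * (indicator {0<..} t * (t powr (p - 1) * f t)))"
    using moment_integrable[OF assms(1-3)] by (simp add: set_integrable_def)
  have "(\<integral>\<^sup>+ t\<in>{0<..}. ennreal (p * t powr (p - 1) * f t) \<partial>lborel)
      = (\<integral>\<^sup>+ t. ennreal (p * (indicator {0<..} t * (t powr (p - 1) * f t))) \<partial>lborel)"
    by (intro nn_integral_cong) (auto simp: indicator_def mult_ac)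
  also have "\<dots> = ennreal (\<integral>t. p * (indicator {0<..} t * (t powr (p - 1) * f t)) \<partial>lborel)"
    using assms by (intro nn_integral_eq_integral i) auto
  finally show ?thesis
    by (simp add: moment_def set_lebesgue_integral_def)
qed

text \<open>Substitution: the Jacobian \<open>c\<close> and the factor \<open>c powr (p - 1)\<close>
  from the weight combine to \<open>c powr p\<close>.\<close>

lemma moment_scale:
  assumes "0 < c"
  shows "moment p (\<lambda>t. f (c * t)) = c powr (- p) * moment p f"
proof -
  have "moment p f = c * (\<integral>t. indicator {0<..} (c * t) * ((c * t) powr (p - 1) * f (c * t)) \<partial>lborel)"
    unfolding moment_def set_lebesgue_integral_def
    using assms by (subst lborel_integral_real_affine[where c = c and t = 0]) auto
  also have "(\<integral>t. indicator {0<..} (c * t) * ((c * t) powr (p - 1) * f (c * t)) \<partial>lborel)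
     = (\<integral>t. c powr (p - 1) * (indicator {0<..} t * (t powr (p - 1) * f (c * t))) \<partial>lborel)"
    using assms
    by (intro Bochner_Integration.integral_cong)
       (auto simp: indicator_def zero_less_mult_iff powr_mult)
  also have "\<dots> = c powr (p - 1) * moment p (\<lambda>t. f (c * t))"
    by (simp add: moment_def set_lebesgue_integral_def)
  finally have "moment p f = c powr p * moment p (\<lambda>t. f (c * t))"
    using assms by (simp add: powr_diff)
  then show ?thesis
    using assms by (simp add: powr_minus)
qed

text \<open>By continuity \<open>f\<close> is positive on some \<open>{0<..<d}\<close>, a set of
  positive measure, so the nonnegative integrand cannot vanish almost everywhere.\<close>

lemma moment_pos:
  assumes "0 < p" and cont: "continuous_on UNIV f" and "\<And>t. R < t \<Longrightarrow> f t = 0" and "\<And>t. 0 \<le> f t"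
    and "0 < f 0"
  shows "0 < moment p f"
proof -
  have i: "integrable lborel (\<lambda>t. indicator {0<..} t * (t powr (p - 1) * f t))"
    using moment_integrable[OF assms(1-3)] by (simp add: set_integrable_def)
  have nn: "0 \<le> moment p f"
    using assms(4) by (auto simp: moment_def set_lebesgue_integral_def intro!: integral_nonneg_AE)
  have "open {t. 0 < f t}"
    using cont by (intro open_Collect_less continuous_intros)
  then obtain d where "0 < d" and d: "\<And>t. \<bar>t\<bar> < d \<Longrightarrow> 0 < f t"
    using \<open>0 < f 0\<close> by (auto simp: open_dist dist_real_def)
  moreover have "moment p f \<noteq> 0"
  proof
    assume "moment p f = 0"
    then have "AE t in lborel. indicator {0<..} t * (t powr (p - 1) * f t) = 0"
      using integral_nonneg_eq_0_iff_AE[OF i] assms(4)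
      by (simp add: moment_def set_lebesgue_integral_def)
    then have "AE t in lborel. t \<notin> {0<..<d}"
    proof eventually_elim
      case (elim t)
      then show ?case using d[of t] by (auto simp: indicator_def)
    qed
    then have "emeasure lborel {0<..<d} = 0"
      by (subst (asm) AE_iff_measurable[of "{0<..<d}"]) auto
    with \<open>0 < d\<close> show False by simp
  qed
  ultimately show ?thesis using nn by simp
qed

section \<open>The extremal profile and its moments\<close>

lemma continuous_profile: "0 < \<alpha> \<Longrightarrow> continuous_on UNIV (profile \<alpha> T)"
  unfolding profile_def divide_inverse by (intro continuous_intros continuous_on_powr') auto

lemma profile_nonneg [simp]: "0 \<le> profile \<alpha> T t"
  by (simp add: profile_def)

lemma profile_eq_0: "0 < T \<Longrightarrow> T \<le> t \<Longrightarrow> profile \<alpha> T t = 0"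
  by (simp add: profile_def)

text \<open>For \<open>T = 1\<close> the moment is a Beta value, and
  \<open>Gamma (1 + p) = p * Gamma p\<close> makes \<open>p\<close> times it the reciprocal of the
  binomial coefficient. Scaling contributes \<open>T powr p\<close>.\<close>

lemma moment_profile:
  assumes "0 < \<alpha>" "0 < p" "0 < T"
  shows "gen_binom (1/\<alpha> + p) (1/\<alpha>) * (p * moment p (profile \<alpha> T)) = T powr p"
proof -
  have "set_integrable lborel {0<..} (\<lambda>t. t powr (p - 1) * profile \<alpha> 1 t)"
    using assms by (intro moment_integrable[where R = 1] continuous_profile profile_eq_0) auto
  then have 0: "moment p (profile \<alpha> 1) = integral {0<..} (\<lambda>t. t powr (p - 1) * profile \<alpha> 1 t)"
    unfolding moment_def by (rule set_borel_integral_eq_integral(2))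
  have "((\<lambda>t. t powr (p - 1) * (1 - t) powr (1/\<alpha>)) has_integral Beta p (1/\<alpha> + 1)) {0..1}"
    using has_integral_Beta_real[of p "1/\<alpha> + 1"] assms by (simp add: add_pos_pos)
  then have "((\<lambda>t. t powr (p - 1) * profile \<alpha> 1 t) has_integral Beta p (1/\<alpha> + 1)) {0..1}"
    by (rule has_integral_eq[rotated]) (auto simp: profile_def max_def)
  \<comment> \<open>The profile vanishes beyond \<open>1\<close>, so the two domains differ only in
    the null set \<open>{0}\<close> as far as the integrand is nonzero.\<close>
  also have "?this \<longleftrightarrow> ((\<lambda>t. t powr (p - 1) * profile \<alpha> 1 t) has_integral Beta p (1/\<alpha> + 1)) {0<..}"
    by (intro has_integral_spike_set_eq; rule negligible_subset[of "{0}"]) (auto simp: profile_def)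
  finally have 1: "moment p (profile \<alpha> 1) = Beta p (1/\<alpha> + 1)"
    unfolding 0 by (rule integral_unique)
  have "profile \<alpha> T = (\<lambda>t. profile \<alpha> 1 (1 / T * t))"
    by (auto simp: profile_def)
  then have 2: "moment p (profile \<alpha> T) = T powr p * Beta p (1/\<alpha> + 1)"
    using moment_scale[of "1/T" p "profile \<alpha> 1"] assms 1 by (simp add: powr_divide powr_minus)
  have "Gamma (1 + p) = p * Gamma p"
    using Gamma_plus1[of p] assms by (simp add: add.commute nonpos_Ints_def)
  moreover define b where "b = 1/\<alpha>"
  moreover have "0 < b"
    using assms by (simp add: b_def)
  then have "Gamma (1 + b) > 0" "Gamma p > 0" "Gamma (1 + b + p) > 0"
    using assms by (auto intro!: Gamma_real_pos add_pos_pos)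
  moreover have "Gamma p \<noteq> 0"
    using Gamma_real_pos[OF \<open>0 < p\<close>] by linarith
  ultimately show ?thesis
    using assms unfolding 2 by (simp add: gen_binom_def Beta_def add_ac)
qed

lemma gen_binom_pos: "0 < \<alpha> \<Longrightarrow> 0 < p \<Longrightarrow> 0 < gen_binom (1/\<alpha> + p) (1/\<alpha>)"
  unfolding gen_binom_def
  by (intro divide_pos_pos mult_pos_pos Gamma_real_pos) (auto intro!: add_pos_pos)

lemma profile_powr: "0 < \<alpha> \<Longrightarrow> profile \<alpha> T t powr \<alpha> = max 0 (1 - t / T)"
  by (simp add: profile_def powr_powr)

section \<open>Single crossing and comparison of moments\<close>

text \<open>The last assumption says that \<open>f powr \<alpha>\<close> lies above the chord from
  height \<open>1\<close> at \<open>0\<close> to its value at \<open>t\<close>. If \<open>f\<close>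
  exceeds the profile at \<open>t\<close>, this chord lies above the line \<open>1 - s/T\<close> for
  all \<open>s < t\<close>. Hence \<open>r\<close> can be the supremum of the points of excess,
  which is finite since \<open>f\<close> vanishes beyond \<open>R\<close>.\<close>

lemma single_crossing:
  assumes "0 < \<alpha>" "0 < T" and nn: "\<And>t. 0 \<le> f t" and R: "\<And>t. R < t \<Longrightarrow> f t = 0"
    and star: "\<And>s t. 0 \<le> s \<Longrightarrow> s \<le> t \<Longrightarrow> 0 < t \<Longrightarrow> 0 < f t \<Longrightarrow> 1 - s/t + s/t * f t powr \<alpha> \<le> f s powr \<alpha>"
  obtains r where "0 \<le> r" "\<And>t. 0 < t \<Longrightarrow> t < r \<Longrightarrow> profile \<alpha> T t \<le> f t"
    "\<And>t. r < t \<Longrightarrow> f t \<le> profile \<alpha> T t"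
proof -
  \<comment> \<open>Inserting \<open>0\<close> keeps the set nonempty and its supremum nonnegative
    even if \<open>f\<close> never exceeds the profile.\<close>
  define P where "P = insert 0 {t. 0 < t \<and> profile \<alpha> T t < f t}"
  have bdd: "bdd_above P"
  proof (rule bdd_aboveI)
    fix t assume "t \<in> P"
    then show "t \<le> max R 0"
      using R[of t] profile_nonneg[of \<alpha> T t] by (cases "R < t") (auto simp: P_def simp del: profile_nonneg)
  qed
  have down: "profile \<alpha> T s \<le> f s" if "t \<in> P" "0 < s" "s < t" for s t
  proof -
    have t: "0 < t" "profile \<alpha> T t < f t" using that by (auto simp: P_def)
    then have "profile \<alpha> T t powr \<alpha> < f t powr \<alpha>"
      using \<open>0 < \<alpha>\<close> by (intro powr_less_mono2) auto
    then have "1 - t / T \<le> f t powr \<alpha>"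
      using \<open>0 < \<alpha>\<close> by (simp add: profile_powr)
    \<comment> \<open>Adding \<open>1 - s / t\<close> to both sides turns this into a comparison of
      the line \<open>1 - s / T\<close> with the chord at \<open>s\<close>.\<close>
    then have "s / t * (1 - t / T) \<le> s / t * f t powr \<alpha>"
      using that by (intro mult_left_mono) auto
    moreover have "s / t * (1 - t / T) = s / t - s / T"
      using t by (simp add: field_simps)
    moreover have "0 < f t" using t(2) profile_nonneg[of \<alpha> T t] by linarith
    ultimately have "1 - s / T \<le> f s powr \<alpha>"
      using star[of s t] that t by simp
    then have "profile \<alpha> T s powr \<alpha> \<le> f s powr \<alpha>"
      using \<open>0 < \<alpha>\<close> by (simp add: profile_powr)
    then show ?thesis
      using \<open>0 < \<alpha>\<close> nn by (meson not_le powr_less_mono2)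
  qed
  show ?thesis
  proof
    show "0 \<le> Sup P" by (intro cSup_upper bdd) (simp add: P_def)
    show "profile \<alpha> T t \<le> f t" if "0 < t" "t < Sup P" for t
      using down less_cSup_iff[OF _ bdd] that by (auto simp: P_def)
    show "f t \<le> profile \<alpha> T t" if "Sup P < t" for t
      using cSup_upper[OF _ bdd, of t] \<open>0 \<le> Sup P\<close> that by (auto simp: P_def not_less[symmetric])
  qed
qed

lemma moment_comparison:
  assumes \<alpha>: "0 < \<alpha>" and T: "0 < T" and pq: "0 < p" "p < q" and nn: "\<And>t. 0 \<le> f t"
    and R: "\<And>t. R < t \<Longrightarrow> f t = 0" and cont: "continuous_on UNIV f"
    and star: "\<And>s t. 0 \<le> s \<Longrightarrow> s \<le> t \<Longrightarrow> 0 < t \<Longrightarrow> 0 < f t \<Longrightarrow> 1 - s/t + s/t * f t powr \<alpha> \<le> f s powr \<alpha>"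
    and eq: "moment p f = moment p (profile \<alpha> T)"
  shows "moment q f \<le> moment q (profile \<alpha> T)"
    and "moment q f = moment q (profile \<alpha> T) \<Longrightarrow> 0 < t \<Longrightarrow> f t = profile \<alpha> T t"
proof -
  obtain r where r: "0 \<le> r" "\<And>t. 0 < t \<Longrightarrow> t < r \<Longrightarrow> profile \<alpha> T t \<le> f t"
    "\<And>t. r < t \<Longrightarrow> f t \<le> profile \<alpha> T t"
    using single_crossing[OF \<alpha> T nn R star] by blast
  define d where "d t = profile \<alpha> T t - f t" for t
  \<comment> \<open>The subtracted term integrates to a multiple of \<open>moment p d = 0\<close>,
    so the integral of \<open>k\<close> is the difference of the \<open>q\<close>-moments; the
    coefficient makes the weight change sign exactly where \<open>d\<close> may.\<close>
  define k where "k t = indicator {0<..} t * ((t powr (q - 1) - r powr (q - p) * t powr (p - 1)) * d t)" for t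
  have cd: "continuous_on UNIV d"
    unfolding d_def by (intro continuous_intros cont continuous_profile \<alpha>)
  have int: "set_integrable lborel {0<..} (\<lambda>t. t powr (s - 1) * f t)"
     "set_integrable lborel {0<..} (\<lambda>t. t powr (s - 1) * profile \<alpha> T t)"
     "set_integrable lborel {0<..} (\<lambda>t. t powr (s - 1) * d t)" if "0 < s" for s
    subgoal by (rule moment_integrable[OF that cont R])
    subgoal by (rule moment_integrable[OF that continuous_profile[OF \<alpha>], of T]) (simp add: profile_eq_0 T)
    subgoal by (rule moment_integrable[OF that cd, of "max R T"]) (simp add: d_def R profile_eq_0 T)
    done
  have md: "moment s d = moment s (profile \<alpha> T) - moment s f" if "0 < s" for s
    unfolding moment_def d_def right_diff_distrib
    by (rule set_integral_diff(2)) (rule int(1,2)[OF that])+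
  have kint: "integrable lborel k"
    and kval: "integral\<^sup>L lborel k = moment q d - r powr (q - p) * moment p d"
  proof -
    have *: "k = (\<lambda>t. indicator {0<..} t * (t powr (q - 1) * d t)
         - r powr (q - p) * (indicator {0<..} t * (t powr (p - 1) * d t)))"
      by (auto simp: k_def algebra_simps)
    show "integrable lborel k" "integral\<^sup>L lborel k = moment q d - r powr (q - p) * moment p d"
      unfolding * moment_def set_lebesgue_integral_def
      using int(3)[of p] int(3)[of q] pq by (simp_all add: set_integrable_def)
  qed
  have fac: "t powr (q - 1) - r powr (q - p) * t powr (p - 1)
      = t powr (p - 1) * (t powr (q - p) - r powr (q - p))" if "0 < t" for t
    using that by (simp add: right_diff_distrib powr_add[symmetric] mult.commute)
  have knn: "0 \<le> k t" for t
  proof (cases "0 < t \<and> t \<noteq> r")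
    case True
    then have "0 \<le> (t powr (q - p) - r powr (q - p)) * d t"
    proof (cases "t < r")
      case True
      then show ?thesis using r \<open>0 < t \<and> t \<noteq> r\<close> pq
        by (intro mult_nonpos_nonpos) (auto simp: d_def intro!: powr_mono2)
    next
      case False
      then show ?thesis using r \<open>0 < t \<and> t \<noteq> r\<close> pq
        by (intro mult_nonneg_nonneg) (auto simp: d_def intro!: powr_mono2)
    qed
    then show ?thesis using True by (simp add: k_def fac mult.assoc)
  next
    case False
    then show ?thesis using fac[of r] by (cases "0 < t") (auto simp: k_def)
  qed
  have kq: "integral\<^sup>L lborel k = moment q (profile \<alpha> T) - moment q f"
    unfolding kval using md[of p] md[of q] pq eq by simp
  have "0 \<le> integral\<^sup>L lborel k"
    using knn by (intro integral_nonneg_AE) auto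
  then show "moment q f \<le> moment q (profile \<alpha> T)"
    using kq by simp
  show "f t = profile \<alpha> T t" if "moment q f = moment q (profile \<alpha> T)" "0 < t"
  proof -
    have "AE t in lborel. k t = 0"
      using integral_nonneg_eq_0_iff_AE[OF kint] knn kq that by simp
    then have ae: "AE t in lborel. t \<in> {0<..} \<longrightarrow> t \<in> {r} \<union> {t. d t = 0}"
    proof eventually_elim
      case (elim t)
      have "t = r" if "0 < t" "t powr (q - p) = r powr (q - p)"
        using that pq r(1) powr_less_mono2[of "q - p" t r] powr_less_mono2[of "q - p" r t]
        by (cases t r rule: linorder_cases) auto
      then show ?case using elim fac[of t] by (auto simp: k_def)
    qed
    \<comment> \<open>The null point \<open>r\<close> is discarded. A closed set containing almost
      every point of the open half-line contains all of it, so continuity of \<open>d\<close>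
      removes the exceptional set.\<close>
    have ae': "AE t\<in>{0<..} in lebesgue. t \<in> {t. d t = 0}"
      using AE_completion[OF ae] AE_completion[OF AE_lborel_singleton[of r]]
      by eventually_elim auto
    have cl: "closed {t. d t = 0}"
      using cd by (intro closed_Collect_eq continuous_intros) auto
    have "t \<in> {t. d t = 0}"
      by (rule mem_closed_if_AE_lebesgue_open[OF open_greaterThan cl ae']) (use that(2) in simp)
    then show ?thesis by (simp add: d_def)
  qed
qed

lemma moment_cmult: "moment p (\<lambda>t. a * f t) = a * moment p f"
  by (simp add: moment_def mult.left_commute)

section \<open>Concavity along rays and boundedness of the support on them\<close>

lemma in_supp: "g x \<noteq> 0 \<Longrightarrow> x \<in> supp g"
  unfolding supp_def by (rule subsetD[OF closure_subset]) simp

lemma alpha_concaveD: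
  assumes "alpha_concave \<alpha> g" "x \<in> supp g" "y \<in> supp g" "0 \<le> u" "u \<le> 1"
  shows "(1 - u) * g x powr \<alpha> + u * g y powr \<alpha> \<le> g ((1 - u) *\<^sub>R x + u *\<^sub>R y) powr \<alpha>"
proof -
  have "1 - u + u = 1" "0 \<le> 1 - u"
    using assms by auto
  then show ?thesis
    using assms unfolding alpha_concave_def concave_on_iff by blast
qed

lemma alpha_concave_ray:
  assumes "alpha_concave \<alpha> g" "0 < g 0" "x \<in> supp g" "0 \<le> u" "u \<le> 1"
  shows "(1 - u) * g 0 powr \<alpha> + u * g x powr \<alpha> \<le> g (u *\<^sub>R x) powr \<alpha>"
  using alpha_concaveD[OF assms(1) in_supp assms(3-5), of 0] assms(2) by simp

text \<open>Markov's inequality.\<close>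

lemma emeasure_superlevel_finite:
  fixes g :: "'a \<Rightarrow> real"
  assumes "integrable M g" "0 < c"
  shows "emeasure M {x \<in> space M. c \<le> g x} < \<infinity>"
proof -
  have [measurable]: "g \<in> borel_measurable M"
    using assms by simp
  have "c * emeasure M {x \<in> space M. c \<le> g x} = (\<integral>\<^sup>+x. ennreal c * indicator {x \<in> space M. c \<le> g x} x \<partial>M)"
    by (subst nn_integral_cmult_indicator) auto
  also have "\<dots> \<le> (\<integral>\<^sup>+x. ennreal (norm (g x)) \<partial>M)"
    using assms(2) by (intro nn_integral_mono) (auto simp: indicator_def intro!: ennreal_leI)
  also have "\<dots> < \<infinity>"
    using assms(1) by (simp add: integrable_iff_bounded)
  finally show ?thesis
    using \<open>0 < c\<close> by (auto simp: ennreal_mult_less_top)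
qed

text \<open>On an unbounded ray, concavity propagates a lower bound near the origin to a tube around
  the ray, which contains infinitely many disjoint balls of equal radius.\<close>

lemma alpha_concave_integrable_ray_bounded:
  fixes g :: "'a::euclidean_space \<Rightarrow> real"
  assumes \<alpha>: "0 < \<alpha>" and nn: "\<And>x. 0 \<le> g x" and cont: "continuous_on UNIV g"
    and int: "integrable lborel g" and conc: "alpha_concave \<alpha> g" and g0: "0 < g 0" and x: "x \<noteq> 0"
  obtains R where "\<And>t. R < t \<Longrightarrow> g (t *\<^sub>R x) = 0"
proof (rule ccontr)
  assume "\<not> thesis"
  then have unb: "\<exists>t>R. g (t *\<^sub>R x) \<noteq> 0" for R
    using that by blast
  have "open {y. g 0 / 2 < g y}"
    using cont by (intro open_Collect_less continuous_intros)
  then obtain r where r: "0 < r" "ball 0 r \<subseteq> {y. g 0 / 2 < g y}"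
    using g0 by (elim openE[where x = 0]) auto
  \<comment> \<open>\<open>k\<close> bounds \<open>(1 - u) * g b' powr \<alpha>\<close> from below
    for \<open>u \<le> 1/2\<close> and \<open>b'\<close> in the ball of radius \<open>r\<close>;
    \<open>c\<close> undoes the power.\<close>
  define k where "k = 1/2 * (g 0 / 2) powr \<alpha>"
  define c where "c = k powr (1/\<alpha>)"
  have "0 < k" "0 < c"
    using g0 by (auto simp: k_def c_def)
  have tube: "c \<le> g (t *\<^sub>R x + b)" if t: "0 \<le> t" and b: "norm b < r / 2" for t b
  proof -
    \<comment> \<open>The point \<open>t *\<^sub>R x + b\<close> is a convex combination of a far
      point \<open>s *\<^sub>R x\<close> and a dilate \<open>b'\<close> of \<open>b\<close>. Taking
      \<open>s > 2 * t\<close> forces \<open>u \<le> 1/2\<close>, so the dilation at most doubles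
      \<open>b\<close> and \<open>b'\<close> stays in the ball of radius \<open>r\<close>.\<close>
    obtain s where s: "2 * t + 1 < s" "g (s *\<^sub>R x) \<noteq> 0"
      using unb by blast
    define u where "u = t / s"
    have u: "0 \<le> u" "u \<le> 1/2" "0 < s"
      using s t by (auto simp: u_def field_simps)
    define b' where "b' = (1 / (1 - u)) *\<^sub>R b"
    have "norm b' = norm b / (1 - u)"
      using u by (simp add: b'_def)
    also have "\<dots> \<le> norm b / (1/2)"
      using u by (intro divide_left_mono) auto
    also have "\<dots> < r"
      using b by simp
    finally have gb: "g 0 / 2 < g b'"
      using r by auto
    have "k \<le> (1 - u) * g b' powr \<alpha>"
      unfolding k_def using u gb \<alpha> g0 by (intro mult_mono powr_mono2) auto
    also have "\<dots> \<le> (1 - u) * g b' powr \<alpha> + u * g (s *\<^sub>R x) powr \<alpha>"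
      using u by simp
    also have "\<dots> \<le> g ((1 - u) *\<^sub>R b' + u *\<^sub>R s *\<^sub>R x) powr \<alpha>"
      using u gb g0 s by (intro alpha_concaveD conc in_supp) auto
    also have "(1 - u) *\<^sub>R b' + u *\<^sub>R s *\<^sub>R x = t *\<^sub>R x + b"
      using u by (simp add: b'_def u_def add.commute)
    finally have "c \<le> (g (t *\<^sub>R x + b) powr \<alpha>) powr (1/\<alpha>)"
      unfolding c_def using \<open>0 < k\<close> \<alpha> by (intro powr_mono2) auto
    then show ?thesis
      using \<alpha> nn by (simp add: powr_powr)
  qed
  define S where "S = {y. c \<le> g y}"
  have [measurable]: "g \<in> borel_measurable borel"
    using cont by (rule borel_measurable_continuous_onI)
  have S: "emeasure lborel S < \<infinity>"
    using emeasure_superlevel_finite[OF int \<open>0 < c\<close>] by (simp add: S_def)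
  have Sm: "S \<in> sets lborel"
    by (simp add: S_def)
  \<comment> \<open>Consecutive centres are at distance \<open>r\<close>, so balls of radius
    \<open>r / 2\<close> are disjoint and stay in the tube.\<close>
  define B where "B n = ball ((real n * (r / norm x)) *\<^sub>R x) (r / 2)" for n :: nat
  have BS: "B n \<subseteq> S" for n
  proof
    fix y assume "y \<in> B n"
    then have "norm (y - (real n * (r / norm x)) *\<^sub>R x) < r / 2"
      by (simp add: B_def dist_norm norm_minus_commute)
    from tube[OF _ this, of "real n * (r / norm x)"] show "y \<in> S"
      using r by (simp add: S_def)
  qed
  have disj: "disjoint_family B"
    unfolding disjoint_family_on_def
  proof (intro ballI impI)
    fix m n :: nat assume "m \<noteq> n"
    have "r * 1 \<le> r * \<bar>real m - real n\<bar>"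
      using \<open>m \<noteq> n\<close> r by (intro mult_left_mono) auto
    also have "\<dots> = dist ((real m * (r / norm x)) *\<^sub>R x) ((real n * (r / norm x)) *\<^sub>R x)"
    proof -
      have "real m * (r / norm x) - real n * (r / norm x) = (real m - real n) * (r / norm x)"
        by (rule left_diff_distrib[symmetric])
      then show ?thesis
        using x r by (simp add: dist_norm scaleR_left_diff_distrib[symmetric] abs_mult)
    qed
    finally show "B m \<inter> B n = {}"
      unfolding B_def by (intro disjoint_ballI) simp
  qed
  define v where "v = measure lborel (ball (0::'a) (r / 2))"
  have "0 < v"
    using r by (simp add: v_def content_ball_pos)
  have vB: "emeasure lborel (B n) = ennreal v" for n
  proof -
    have "emeasure lborel (B n) = ennreal (measure lborel (B n))"
      using less_imp_neq[OF emeasure_lborel_ball_finite] unfolding B_def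
      by (intro emeasure_eq_ennreal_measure) (simp only: infinity_ennreal_def not_False_eq_True)
    then show ?thesis
      using r by (simp add: B_def v_def content_ball_conv_unit_ball[of "r/2"])
  qed
  obtain N :: nat where N: "measure lborel S < real N * v"
    using reals_Archimedean3[OF \<open>0 < v\<close>] by blast
  have "ennreal (real N * v) = (\<Sum>n<N. emeasure lborel (B n))"
    using \<open>0 < v\<close> by (simp add: vB ennreal_mult ennreal_of_nat_eq_real_of_nat)
  also have "\<dots> = emeasure lborel (\<Union>n<N. B n)"
    using disj by (intro sum_emeasure) (auto simp: B_def disjoint_family_on_def)
  also have "\<dots> \<le> emeasure lborel S"
    using BS by (intro emeasure_mono Sm) auto
  also have "\<dots> = ennreal (measure lborel S)"
    using less_imp_neq[OF S] by (intro emeasure_eq_ennreal_measure) simp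
  finally show False
    using N by (simp add: ennreal_le_iff)
qed

section \<open>Membership in scaled Ball bodies\<close>

text \<open>At the origin \<open>g\<close> is constant along the ray, which the moment lemmas do not
  cover. The part of the integral up to \<open>1\<close> already equals \<open>g 0\<close>.\<close>

lemma zero_in_ball_body:
  assumes "0 < p" "0 < g 0"
  shows "0 \<in> ball_body p g"
proof -
  have "((\<lambda>t. g 0 * p * t powr (p - 1)) has_integral (g 0 * p * (1 / p))) {0..1}"
    using has_integral_powr_from_0[of "p - 1" 1] assms by (intro has_integral_mult_right) auto
  from nn_integral_has_integral_lebesgue[OF _ this]
  have "ennreal (g 0) = (\<integral>\<^sup>+ t. ennreal (indicator {0..1} t * (g 0 * p * t powr (p - 1))) \<partial>lborel)"
    using assms by (simp add: ennreal_mult' ennreal_indicator)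
  also have "\<dots> \<le> (\<integral>\<^sup>+ t\<in>{0<..}. ennreal (p * t powr (p - 1) * g (t *\<^sub>R 0)) \<partial>lborel)"
    using assms by (intro nn_integral_mono) (auto simp: indicator_def mult_ac)
  finally show ?thesis
    by (simp add: ball_body_def)
qed

text \<open>The dilation factor is the \<open>p\<close>-th root of \<open>B\<close>, so undoing it
  on \<open>x\<close> multiplies the moment of order \<open>p\<close> by \<open>B\<close>
  itself.\<close>

lemma mem_scaled_ball_body:
  fixes g :: "'a::euclidean_space \<Rightarrow> real"
  assumes p: "0 < p" and B: "0 < B" and nn: "\<And>x. 0 \<le> g x" and cont: "continuous_on UNIV g"
    and g0: "0 < g 0" and R: "\<And>t. R < t \<Longrightarrow> g (t *\<^sub>R x) = 0"
  shows "x \<in> (\<lambda>x. (B powr (1/p)) *\<^sub>R x) ` ball_body p g \<longleftrightarrow>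
    1 \<le> B * (p * moment p (\<lambda>t. g (t *\<^sub>R x) / g 0))"
proof -
  define c where "c = B powr (1/p)"
  have c: "0 < c" "c powr p = B"
    using B p by (auto simp: c_def powr_powr)
  define y where "y = (1 / c) *\<^sub>R x"
  define m where "m = moment p (\<lambda>t. g (t *\<^sub>R x) / g 0)"
  have "(\<lambda>t. g (t *\<^sub>R y)) = (\<lambda>t. g 0 * (g (((1 / c) * t) *\<^sub>R x) / g 0))"
    using g0 by (auto simp: y_def)
  then have m: "moment p (\<lambda>t. g (t *\<^sub>R y)) = g 0 * B * m"
    using moment_scale[of "1/c" p "\<lambda>t. g (t *\<^sub>R x) / g 0"] c
    by (simp only: moment_cmult m_def) (simp add: powr_divide powr_minus)
  have nnint: "(\<integral>\<^sup>+ t\<in>{0<..}. ennreal (p * t powr (p - 1) * g (t *\<^sub>R y)) \<partial>lborel)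
      = ennreal (p * (g 0 * B * m))"
    unfolding m[symmetric]
  proof (rule moment_eq_nn_integral[OF p])
    show "continuous_on UNIV (\<lambda>t. g (t *\<^sub>R y))"
      by (intro continuous_on_compose2[OF cont] continuous_intros) auto
    show "g (t *\<^sub>R y) = 0" if "c * R < t" for t
      using R[of "t / c"] that c by (simp add: y_def field_simps)
  qed (rule nn)
  have "x \<in> (\<lambda>x. c *\<^sub>R x) ` ball_body p g \<longleftrightarrow> y \<in> ball_body p g"
    using c by (force simp: y_def)
  also have "\<dots> \<longleftrightarrow> ennreal (g 0) \<le> ennreal (p * (g 0 * B * m))"
    unfolding ball_body_def mem_Collect_eq nnint ..
  \<comment> \<open>\<open>ennreal\<close> clips negative reals to \<open>0\<close>; positivity of
    \<open>g 0\<close> makes the comparison faithful.\<close>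
  also have "\<dots> \<longleftrightarrow> g 0 \<le> p * (g 0 * B * m)"
    using g0 by (subst ennreal_le_iff2) linarith
  also have "\<dots> \<longleftrightarrow> 1 \<le> B * (p * m)"
    using mult_le_cancel_left_pos[OF g0, of 1 "B * (p * m)"] by (simp add: mult_ac)
  finally show ?thesis
    unfolding c_def m_def .
qed

section \<open>From profiles on rays to the extremal function\<close>

text \<open>If the profile on the ray of \<open>x\<close> ends at \<open>T\<close>, the support
  meets that ray exactly up to \<open>T *\<^sub>R x\<close>. Thus the Minkowski functional at
  \<open>x\<close> is \<open>1 / T\<close>, and the formula is the profile evaluated at
  \<open>1\<close>.\<close>

lemma extremal_form:
  fixes g :: "'a::euclidean_space \<Rightarrow> real"
  assumes \<alpha>: "0 < \<alpha>" and nn: "\<And>x. 0 \<le> g x" and conc: "alpha_concave \<alpha> g" and g0: "0 < g 0"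
    and ray: "\<And>x. x \<noteq> 0 \<Longrightarrow> \<exists>T>0. \<forall>t>0. g (t *\<^sub>R x) / g 0 = profile \<alpha> T t"
  shows "sup_norm g = ennreal (g 0)"
    and "g x / g 0 = (1 - minkowski_functional (supp g) x) powr (1/\<alpha>) * indicator (supp g) x"
proof -
  have le: "g y \<le> g 0" for y
  proof (cases "y = 0")
    case False
    from ray[OF this] obtain T where "T > 0" "g (1 *\<^sub>R y) / g 0 = profile \<alpha> T 1"
      using zero_less_one by blast
    moreover have "profile \<alpha> T 1 \<le> 1"
      using \<alpha> \<open>T > 0\<close> by (auto simp: profile_def intro!: powr_le1)
    ultimately show ?thesis using g0 by (simp add: field_simps)
  qed simp
  show "sup_norm g = ennreal (g 0)"
    unfolding sup_norm_def
  proof (rule antisym)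
    show "(SUP x. ennreal \<bar>g x\<bar>) \<le> ennreal (g 0)"
      using le nn by (intro SUP_least ennreal_leI) simp
    show "ennreal (g 0) \<le> (SUP x. ennreal \<bar>g x\<bar>)"
      using g0 by (intro SUP_upper2[of 0]) auto
  qed
  have zero: "0 \<in> supp g"
    using g0 by (intro in_supp) simp
  have scaled_iff: "x \<in> (\<lambda>y. l *\<^sub>R y) ` supp g \<longleftrightarrow> (1 / l) *\<^sub>R x \<in> supp g" if "0 < l" for l
    using that by (auto simp: image_iff intro!: bexI[of _ "(1 / l) *\<^sub>R x"])
  show "g x / g 0 = (1 - minkowski_functional (supp g) x) powr (1/\<alpha>) * indicator (supp g) x"
  proof (cases "x = 0")
    case True
    then have "{l. 0 < l \<and> x \<in> (\<lambda>y. l *\<^sub>R y) ` supp g} = {0<..}"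
      using zero by (auto simp: scaled_iff)
    then have "minkowski_functional (supp g) x = 0"
      by (simp add: minkowski_functional_def)
    then show ?thesis using True g0 zero by simp
  next
    case False
    from ray[OF this] obtain T
      where T: "T > 0" and eq: "\<And>t. 0 < t \<Longrightarrow> g (t *\<^sub>R x) / g 0 = profile \<alpha> T t"
      by blast
    have supp: "t *\<^sub>R x \<in> supp g \<longleftrightarrow> t \<le> T" if "0 < t" for t
    proof
      assume ts: "t *\<^sub>R x \<in> supp g"
      show "t \<le> T"
      \<comment> \<open>A support point beyond \<open>T\<close>, even one where \<open>g\<close>
        vanishes, would by concavity on the segment from \<open>0\<close> make \<open>g\<close>
        positive at \<open>T *\<^sub>R x\<close>, where the profile is \<open>0\<close>.\<close>
      proof (rule ccontr)
        assume "\<not> t \<le> T"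
        then have u: "0 \<le> T / t" "T / t < 1"
          using T by auto
        have "g (T *\<^sub>R x) = 0"
          using eq[OF T] T g0 by (simp add: profile_eq_0)
        moreover have "0 < (1 - T / t) * g 0 powr \<alpha> + T / t * g (t *\<^sub>R x) powr \<alpha>"
          using u g0 by (intro add_pos_nonneg mult_pos_pos mult_nonneg_nonneg) auto
        ultimately show False
          using alpha_concave_ray[OF conc g0 ts u(1)] u \<open>0 < t\<close> by simp
      qed
    next
      assume "t \<le> T"
      \<comment> \<open>Strictly before \<open>t\<close> the profile is positive; closedness of the
        support then adds the endpoint, which matters for \<open>t = T\<close>.\<close>
      have "s *\<^sub>R x \<in> supp g" if "s \<in> {0<..<t}" for s
      proof (rule in_supp)
        have "profile \<alpha> T s > 0"
          using that \<open>t \<le> T\<close> by (auto simp: profile_def)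
        then show "g (s *\<^sub>R x) \<noteq> 0"
          using eq[of s] that by auto
      qed
      then have "closure {0<..<t} \<subseteq> (\<lambda>s. s *\<^sub>R x) -` supp g"
        by (intro closure_minimal closed_vimage continuous_intros) (auto simp: supp_def)
      then show "t *\<^sub>R x \<in> supp g"
        using \<open>0 < t\<close> by (auto simp: subset_iff)
    qed
    have "{l. 0 < l \<and> x \<in> (\<lambda>y. l *\<^sub>R y) ` supp g} = {1 / T..}"
    proof (intro set_eqI)
      fix l
      have "0 < l" if "1 / T \<le> l"
        using that T by (intro less_le_trans[of 0 "1 / T" l]) auto
      then show "l \<in> {l. 0 < l \<and> x \<in> (\<lambda>y. l *\<^sub>R y) ` supp g} \<longleftrightarrow> l \<in> {1 / T..}"
        using scaled_iff[of l] supp[of "1 / l"] T by (auto simp only: mem_Collect_eq atLeast_iff) (auto simp: field_simps)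
    qed
    then have mf: "minkowski_functional (supp g) x = 1 / T"
      by (simp add: minkowski_functional_def)
    \<comment> \<open>For \<open>T \<ge> 1\<close> the truncation in the profile is inactive; for
      \<open>T < 1\<close> both sides vanish, the right one through the indicator.\<close>
    show ?thesis
      unfolding mf using eq[of 1] supp[of 1] T by (auto simp: profile_def indicator_def max_def)
  qed
qed

section \<open>Comparing the Ball bodies ray by ray\<close>

theorem theorem1p2:
  fixes \<alpha> :: real and g :: "real ^ 'n \<Rightarrow> real"
  assumes "\<alpha> > 0"
    and "\<And>x. g x \<ge> 0"
    and "continuous_on UNIV g"
    and "integrable lborel g"
    and "alpha_concave \<alpha> g"
    and "g 0 > 0"
  shows "(\<forall>p q. 0 < p \<and> p < q \<longrightarrow>
            (\<lambda>x. (gen_binom (1/\<alpha> + q) (1/\<alpha>) powr (1/q)) *\<^sub>R x) ` ball_body q g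
            \<subseteq> (\<lambda>x. (gen_binom (1/\<alpha> + p) (1/\<alpha>) powr (1/p)) *\<^sub>R x) ` ball_body p g)
       \<and> ((\<exists>p q. 0 < p \<and> p < q \<and>
            (\<lambda>x. (gen_binom (1/\<alpha> + q) (1/\<alpha>) powr (1/q)) *\<^sub>R x) ` ball_body q g
            = (\<lambda>x. (gen_binom (1/\<alpha> + p) (1/\<alpha>) powr (1/p)) *\<^sub>R x) ` ball_body p g)
          \<longrightarrow> sup_norm g = ennreal (g 0)
            \<and> (\<forall>x. g x / g 0 =
                   (1 - minkowski_functional (supp g) x) powr (1/\<alpha>) * indicator (supp g) x))"
proof -
  note \<alpha> = assms(1) and nn = assms(2) and cont = assms(3) and conc = assms(5) and g0 = assms(6)
  define F where "F x t = g (t *\<^sub>R x) / g 0" for x t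
  \<comment> \<open>By \<open>moment_profile\<close>, \<open>D p x powr (1/p)\<close> is the
    endpoint \<open>T\<close> of the profile with the same \<open>p\<close>-th moment as
    \<open>F x\<close>. Away from \<open>0\<close>, \<open>S p\<close> is the set where
    \<open>D p\<close> is at least \<open>1\<close>.\<close>
  define D where "D p x = gen_binom (1/\<alpha> + p) (1/\<alpha>) * (p * moment p (F x))" for p x
  define S where "S p = (\<lambda>x. (gen_binom (1/\<alpha> + p) (1/\<alpha>) powr (1/p)) *\<^sub>R x) ` ball_body p g" for p
  have Fcont: "continuous_on UNIV (F x)" for x
    unfolding F_def using g0 by (intro continuous_intros continuous_on_compose2[OF cont]) auto
  have Fnn: "0 \<le> F x t" for x t
    using nn g0 by (simp add: F_def)
  have Fbdd: "\<exists>R. \<forall>t>R. F x t = 0" if "x \<noteq> 0" for x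
    using alpha_concave_integrable_ray_bounded[OF assms that] unfolding F_def by (metis div_0)
  have star: "1 - s / t + s / t * F x t powr \<alpha> \<le> F x s powr \<alpha>"
    if "0 \<le> s" "s \<le> t" "0 < t" "0 < F x t" for x s t
  proof -
    have "t *\<^sub>R x \<in> supp g"
      using that by (intro in_supp) (auto simp: F_def)
    from alpha_concave_ray[OF conc g0 this, of "s / t"]
    have "(1 - s / t) * g 0 powr \<alpha> + s / t * g (t *\<^sub>R x) powr \<alpha> \<le> g (s *\<^sub>R x) powr \<alpha>"
      using that by simp
    then have "((1 - s / t) * g 0 powr \<alpha> + s / t * g (t *\<^sub>R x) powr \<alpha>) / g 0 powr \<alpha>
        \<le> g (s *\<^sub>R x) powr \<alpha> / g 0 powr \<alpha>"
      by (rule divide_right_mono) simp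
    then show ?thesis
      using g0 nn by (simp add: F_def powr_divide add_divide_distrib)
  qed
  have S_iff: "x \<in> S p \<longleftrightarrow> 1 \<le> D p x" if p: "0 < p" and x: "x \<noteq> 0" for p x
  proof -
    obtain R where R: "\<And>t. R < t \<Longrightarrow> g (t *\<^sub>R x) = 0"
      using Fbdd[OF x] g0 by (auto simp: F_def)
    from mem_scaled_ball_body[OF p gen_binom_pos[OF \<alpha> p] nn cont g0 R]
    show ?thesis
      by (simp only: S_def D_def F_def[abs_def])
  qed
  have Dpos: "0 < D p x" if p: "0 < p" and x: "x \<noteq> 0" for p x
  proof -
    obtain R where "\<And>t. R < t \<Longrightarrow> F x t = 0"
      using Fbdd[OF x] by blast
    then have "0 < moment p (F x)"
      by (rule moment_pos[OF p Fcont _ Fnn]) (simp_all add: F_def less_imp_neq[OF g0, symmetric])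
    then show ?thesis
      using gen_binom_pos[OF \<alpha> p] p by (simp add: D_def)
  qed
  have D_scale: "D p (c *\<^sub>R x) = c powr (- p) * D p x" if "0 < c" for c p x
  proof -
    have "F (c *\<^sub>R x) = (\<lambda>t. F x (c * t))"
      by (auto simp: F_def mult.commute)
    then show ?thesis
      using moment_scale[OF that, of p "F x"] by (simp add: D_def)
  qed
  \<comment> \<open>This is monotonicity of \<open>D p x powr (1/p)\<close> in \<open>p\<close>: the
    \<open>q\<close>-th moment of \<open>F x\<close> is at most that of the profile matched at order
    \<open>p\<close>.\<close>
  have compare: "D q x \<le> (D p x powr (1/p)) powr q"
    and compare_eq: "D q x = (D p x powr (1/p)) powr q \<longrightarrow> (\<forall>t>0. F x t = profile \<alpha> (D p x powr (1/p)) t)"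
    if pq: "0 < p" "p < q" and x: "x \<noteq> 0" for p q x
  proof -
    define T where "T = D p x powr (1/p)"
    have T: "0 < T" "T powr p = D p x"
      using Dpos[OF pq(1) x] pq by (auto simp: T_def powr_powr)
    obtain R where R: "\<And>t. R < t \<Longrightarrow> F x t = 0"
      using Fbdd[OF x] by blast
    have "0 < q" using pq by simp
    note B = gen_binom_pos[OF \<alpha> pq(1)] gen_binom_pos[OF \<alpha> \<open>0 < q\<close>]
    have mp: "moment p (F x) = moment p (profile \<alpha> T)"
      using moment_profile[OF \<alpha> pq(1) T(1)] B pq by (simp add: T(2) D_def)
    note mq = moment_profile[OF \<alpha> \<open>0 < q\<close> T(1)]
    have "moment q (F x) \<le> moment q (profile \<alpha> T)"
      by (rule moment_comparison(1)[OF \<alpha> T(1) pq _ R Fcont _ mp]) (use Fnn star in auto)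
    then have "D q x \<le> T powr q"
      unfolding D_def mq[symmetric] using B \<open>0 < q\<close> by (intro mult_left_mono) auto
    then show "D q x \<le> (D p x powr (1/p)) powr q"
      by (simp only: T_def)
    show "D q x = (D p x powr (1/p)) powr q \<longrightarrow> (\<forall>t>0. F x t = profile \<alpha> (D p x powr (1/p)) t)"
      unfolding T_def[symmetric]
    proof (intro impI allI)
      fix t :: real
      assume "D q x = T powr q" and t: "0 < t"
      then have mq': "moment q (F x) = moment q (profile \<alpha> T)"
        unfolding D_def mq[symmetric] using B \<open>0 < q\<close> by simp
      show "F x t = profile \<alpha> T t"
        by (rule moment_comparison(2)[OF \<alpha> T(1) pq _ R Fcont _ mp mq' t]) (use Fnn star in auto)
    qed
  qed
  have incl: "S q \<subseteq> S p" if pq: "0 < p" "p < q" for p q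
  proof
    fix x assume x: "x \<in> S q"
    show "x \<in> S p"
    proof (cases "x = 0")
      case True
      then show ?thesis
        using zero_in_ball_body[OF pq(1), of g] g0 by (force simp: S_def)
    next
      case False
      have "1 \<le> D q x"
        using S_iff[of q x] x False pq by simp
      also note compare[OF pq False]
      finally have "1 \<le> D p x powr (q / p)"
        by (simp add: powr_powr)
      have "1 \<le> D p x"
      proof (rule ccontr)
        assume "\<not> 1 \<le> D p x"
        then have "D p x powr (q / p) < 1 powr (q / p)"
          using Dpos[OF pq(1) False] pq by (intro powr_less_mono2) auto
        then show False using \<open>1 \<le> D p x powr (q / p)\<close> by simp
      qed
      then show ?thesis
        using S_iff[OF pq(1) False] by simp
    qed
  qed
  have rays: "\<exists>T>0. \<forall>t>0. g (t *\<^sub>R x) / g 0 = profile \<alpha> T t"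
    if pq: "0 < p" "p < q" and eq: "S q = S p" and x: "x \<noteq> 0" for p q x
  proof -
    define T where "T = D p x powr (1/p)"
    have T: "0 < T" "T powr p = D p x"
      using Dpos[OF pq(1) x] pq by (auto simp: T_def powr_powr)
    \<comment> \<open>Rescaling puts the point on the boundary level of \<open>S p\<close>. Since it
      also lies in \<open>S q\<close>, homogeneity yields the reverse of \<open>compare\<close>,
      hence equality on this ray.\<close>
    have "D p (T *\<^sub>R x) = 1"
      using D_scale[OF T(1), of p x] T Dpos[OF pq(1) x] by (simp add: powr_minus)
    then have "1 \<le> D q (T *\<^sub>R x)"
      using S_iff[of p "T *\<^sub>R x"] S_iff[of q "T *\<^sub>R x"] eq pq T(1) x by simp
    then have "T powr q \<le> D q x"
      using D_scale[OF T(1), of q x] T(1) by (simp add: powr_minus field_simps)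
    then have "D q x = (D p x powr (1/p)) powr q"
      using compare[OF pq x] by (simp add: T_def)
    then have "\<forall>t>0. F x t = profile \<alpha> T t"
      using compare_eq[OF pq x] by (simp only: T_def simp_thms)
    then show ?thesis
      unfolding F_def using T(1) by (intro exI[of _ T] conjI)
  qed
  show ?thesis
    unfolding S_def[symmetric]
  proof (intro conjI allI impI)
    show "S q \<subseteq> S p" if "0 < p \<and> p < q" for p q
      using incl that by simp
  next
    assume "\<exists>p q. 0 < p \<and> p < q \<and> S q = S p"
    then obtain p q where pq: "0 < p" "p < q" "S q = S p"
      by (elim exE conjE)
    note extremal = extremal_form[OF \<alpha> nn conc g0 rays[OF pq]]
    show "sup_norm g = ennreal (g 0)"
      by (rule extremal(1))
    show "g x / g 0 = (1 - minkowski_functional (supp g) x) powr (1/\<alpha>) * indicator (supp g) x" for x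
      by (rule extremal(2))
  qed
qed

end
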